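(* Let $q\in\mathbb{N}$ be a prime with $q\equiv\pm1\pmod 5$. Write $q-1=2^k\ell$ with $k\in\mathbb{N}$ and $\ell\in\mathbb{N}$ odd. Let $C=\begin{pmatrix}0&1\\1&1\end{pmatrix}$. Then $q$ has the Midy property in the golden ratio base $\tau=\frac{1+\sqrt5}{2}$ if and only if the list of matrices $C^{2\ell},C^{4\ell},\ldots,C^{2^{k-1}\ell}$ (that is, $C^{2^j\ell}$ for $1\le j\le k-1$; the list is empty if $k=1$) contains a matrix which equals $-I$ modulo $q$.
   Context: For real $\beta>1$, the $\beta$-transformation is $T:[0,1]\to[0,1)$, $T(x)=\beta x-\lfloor \beta x\rfloor$. The $\beta$-expansion of $x\in(0,1)$ is $(x)_\beta=0.x_1x_2x_3\cdots$ with digits $x_i=\lfloor \beta T^{i-1}(x)\rfloor$, so that $x=\sum_{i\ge1}x_i\beta^{-i}$. It is purely periodic if the digit sequence $x_1x_2x_3\cdots$ equals $(c_1\cdots c_m)^\omega$ (infinite repetition of the block $c_1\cdots c_m$) for some $m\ge 1$. Midy property: $q\in\mathbb{N}$ has the Midy property in base $\beta$ if there exists a positive integer $p<q$ coprime with $q$ such that (a) the $\beta$-expansion of $p/q$ is purely periodic, $(p/q)_\beta=0.(c_1c_2\cdots c_{2n})^\omega$, where $2n$ (an even number, $n\ge1$) is the length of the shortest period; and (b) $x+y=\beta^n-1$, where $x=\sum_{i=1}^n c_i\beta^{n-i}$ and $y=\sum_{i=1}^n c_{n+i}\beta^{n-i}$. Matrix congruences modulo $q$ are entrywise; $I$ is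 the $2\times2$ identity matrix. *)

theory Defs
  imports
    Complex_Main
    "HOL-Number_Theory.Cong"
    "HOL-Computational_Algebra.Primes"
    "Jordan_Normal_Form.Matrix"
begin

section \<open>Beta-expansions\<close>

definition beta_T :: "real \<Rightarrow> real \<Rightarrow> real" where
  "beta_T \<beta> x = \<beta> * x - of_int \<lfloor>\<beta> * x\<rfloor>"

text \<open>Digits are indexed from 1; the value at index 0 is junk.\<close>

definition beta_digit :: "real \<Rightarrow> real \<Rightarrow> nat \<Rightarrow> int" where
  "beta_digit \<beta> x i = \<lfloor>\<beta> * (beta_T \<beta> ^^ (i - 1)) x\<rfloor>"

text \<open>
  The digit sequence of \<open>x\<close> is the infinite repetition of the block
  \<open>c 1, ..., c m\<close>. Values of \<open>c\<close> outside \<open>{1..m}\<close> are irrelevant.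
\<close>

definition beta_expansion_repeats :: "real \<Rightarrow> real \<Rightarrow> nat \<Rightarrow> (nat \<Rightarrow> int) \<Rightarrow> bool" where
  "beta_expansion_repeats \<beta> x m c \<longleftrightarrow>
     m \<ge> 1 \<and> (\<forall>i\<ge>1. beta_digit \<beta> x i = c ((i - 1) mod m + 1))"

definition midy_property :: "real \<Rightarrow> nat \<Rightarrow> bool" where
  "midy_property \<beta> q \<longleftrightarrow>
     (\<exists>p>0. p < q \<and> coprime p q \<and>
        (\<exists>n\<ge>1. \<exists>c.
           beta_expansion_repeats \<beta> (real p / real q) (2 * n) c \<and>
           (\<forall>m c'. beta_expansion_repeats \<beta> (real p / real q) m c' \<longrightarrow> 2 * n \<le> m) \<and>
           (\<Sum>i=1..n. of_int (c i) * \<beta> ^ (n - i)) +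
           (\<Sum>i=1..n. of_int (c (n + i)) * \<beta> ^ (n - i)) = \<beta> ^ n - 1))"

definition golden_ratio :: real where
  "golden_ratio = (1 + sqrt 5) / 2"

section \<open>Matrices\<close>

definition mat_cong :: "int mat \<Rightarrow> int mat \<Rightarrow> nat \<Rightarrow> bool" where
  "mat_cong A B q \<longleftrightarrow>
     dim_row A = dim_row B \<and> dim_col A = dim_col B \<and>
     (\<forall>i<dim_row A. \<forall>j<dim_col A. [A $$ (i, j) = B $$ (i, j)] (mod int q))"

definition fib_mat :: "int mat" where
  "fib_mat = mat_of_rows_list 2 [[0, 1], [1, 1]]"

end

theory Submission
  imports Defs "HOL-Number_Theory.Quadratic_Reciprocity"
begin

text \<open>
  Write \<open>\<tau>\<close> for the golden ratio. On \<open>(a + b\<tau>) / q\<close> the \<open>\<tau>\<close>-transformation acts as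
  \<open>(a, b) \<mapsto> (b - d q, a + b)\<close>, which is multiplication by \<open>C\<close> modulo \<open>q\<close>. The natural extension
  of the transformation lives on a planar domain that contains \<open>(p/q, p/q)\<close> and meets every coset
  of the lattice \<open>\<int>[\<tau>]\<close> at most once. Hence \<open>T\<^sup>m (p/q) = p/q\<close> holds iff
  \<open>C\<^sup>m = I\<close> modulo \<open>q\<close>, and \<open>T\<^sup>n (p/q) = 1 - p/q\<close> iff \<open>C\<^sup>n = -I\<close> modulo \<open>q\<close>. Summing the digits
  shows that the Midy condition for a minimal period \<open>2n\<close> is exactly \<open>T\<^sup>n (p/q) = 1 - p/q\<close>.
  So the Midy property says that \<open>C\<close> has even order \<open>2n\<close> with \<open>C\<^sup>n = -I\<close>; this order divides
  \<open>q - 1\<close> because 5 is a square modulo \<open>q\<close>, and \<open>n\<close> is even because \<open>det C = -1\<close>.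
\<close>

section \<open>Periodic beta-expansions\<close>

lemma beta_T_bounds: "0 \<le> beta_T \<beta> x" "beta_T \<beta> x < 1"
  by (simp_all add: beta_T_def, linarith)

lemma funpow_beta_T_bounds:
  assumes "0 \<le> x" "x < 1"
  shows "0 \<le> (beta_T \<beta> ^^ n) x \<and> (beta_T \<beta> ^^ n) x < 1"
  using assms by (cases n) (simp_all add: beta_T_bounds)

lemma funpow_beta_T_Suc:
  "(beta_T \<beta> ^^ Suc n) x = \<beta> * (beta_T \<beta> ^^ n) x - of_int (beta_digit \<beta> x (Suc n))"
  by (simp add: beta_T_def beta_digit_def)

lemma beta_T_diff_of_digits_eq:
  assumes "\<And>i. i \<ge> 1 \<Longrightarrow> beta_digit \<beta> x i = beta_digit \<beta> y i"
  shows "(beta_T \<beta> ^^ n) x - (beta_T \<beta> ^^ n) y = \<beta> ^ n * (x - y)"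
proof (induction n)
  case (Suc n)
  have "(beta_T \<beta> ^^ Suc n) x - (beta_T \<beta> ^^ Suc n) y
      = \<beta> * ((beta_T \<beta> ^^ n) x - (beta_T \<beta> ^^ n) y)"
    unfolding funpow_beta_T_Suc using assms[of "Suc n"] by (simp add: algebra_simps)
  with Suc show ?case by simp
qed simp

text \<open>Equal digits cancel in the recursion, so the gap between the two orbits grows like
  \<open>\<beta> ^ n\<close>, whereas both orbits stay in [0, 1).\<close>

lemma eq_if_beta_digits_eq:
  assumes "\<beta> > 1" "0 \<le> x" "x < 1" "0 \<le> y" "y < 1"
    and "\<And>i. i \<ge> 1 \<Longrightarrow> beta_digit \<beta> x i = beta_digit \<beta> y i"
  shows "x = y"
proof (rule ccontr)
  assume "x \<noteq> y"
  obtain n where n: "1 / \<bar>x - y\<bar> < \<beta> ^ n"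
    using real_arch_pow[OF \<open>\<beta> > 1\<close>] by blast
  have "1 < \<beta> ^ n * \<bar>x - y\<bar>"
    using n \<open>x \<noteq> y\<close> by (simp add: field_simps)
  also have "\<dots> = \<bar>(beta_T \<beta> ^^ n) x - (beta_T \<beta> ^^ n) y\<bar>"
    using \<open>\<beta> > 1\<close> by (simp add: beta_T_diff_of_digits_eq[OF assms(6)] abs_mult)
  also have "\<dots> < 1"
    using funpow_beta_T_bounds[of x n \<beta>] funpow_beta_T_bounds[of y n \<beta>] assms by linarith
  finally show False .
qed

lemma beta_digit_shift:
  assumes "i \<ge> 1"
  shows "beta_digit \<beta> ((beta_T \<beta> ^^ m) x) i = beta_digit \<beta> x (i + m)"
proof -
  have "i + m - 1 = (i - 1) + m"
    using assms by simp
  then show ?thesis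
    by (simp add: beta_digit_def funpow_add)
qed

text \<open>Applying the transformation \<open>m\<close> times drops the first \<open>m\<close>
  digits, and digits determine the point. A repeating digit block is therefore the same thing as a
  return of the orbit to \<open>x\<close>.\<close>

lemma beta_expansion_repeats_iff:
  assumes "\<beta> > 1" "0 \<le> x" "x < 1"
  shows "beta_expansion_repeats \<beta> x m c \<longleftrightarrow>
    m \<ge> 1 \<and> (beta_T \<beta> ^^ m) x = x \<and> (\<forall>i\<in>{1..m}. c i = beta_digit \<beta> x i)"
    (is "?L \<longleftrightarrow> ?R")
proof
  assume L: ?L
  then have m: "m \<ge> 1"
    unfolding beta_expansion_repeats_def by blast
  from L have dig: "beta_digit \<beta> x i = c ((i - 1) mod m + 1)" if "i \<ge> 1" for i
    using that unfolding beta_expansion_repeats_def by blast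
  have "(beta_T \<beta> ^^ m) x = x"
  proof (rule eq_if_beta_digits_eq[OF \<open>\<beta> > 1\<close>])
    fix i :: nat assume i: "i \<ge> 1"
    then have "i + m - 1 = (i - 1) + m" by simp
    then have "(i + m - 1) mod m = (i - 1) mod m" by simp
    then show "beta_digit \<beta> ((beta_T \<beta> ^^ m) x) i = beta_digit \<beta> x i"
      using i dig[of i] dig[of "i + m"] by (simp add: beta_digit_shift)
  qed (use assms funpow_beta_T_bounds[of x m \<beta>] in auto)
  moreover have "c i = beta_digit \<beta> x i" if "i \<in> {1..m}" for i
  proof -
    have "(i - 1) mod m + 1 = i"
      using that by auto
    then show ?thesis
      using that dig[of i] by simp
  qed
  ultimately show ?R
    using m by blast
next
  assume R: ?R
  have "beta_digit \<beta> x i = c ((i - 1) mod m + 1)" if "i \<ge> 1" for i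
  proof -
    have "(i - 1) mod m + 1 \<in> {1..m}"
      using R mod_less_divisor[of m "i - 1"] by (auto simp: Suc_le_eq simp del: mod_less_divisor)
    then have "c ((i - 1) mod m + 1) = beta_digit \<beta> x ((i - 1) mod m + 1)"
      using R by blast
    also have "\<dots> = beta_digit \<beta> x i"
      using R by (simp add: beta_digit_def funpow_mod_eq)
    finally show ?thesis ..
  qed
  with R show ?L
    unfolding beta_expansion_repeats_def by blast
qed

text \<open>Unrolls \<open>funpow_beta_T_Suc\<close> from time \<open>k\<close> to time
  \<open>k + n\<close>. The cases \<open>k = 0\<close> and \<open>k = n\<close> give the two
  half-block sums of the Midy condition.\<close>

lemma sum_beta_digits:
  "(\<Sum>i=1..n. of_int (beta_digit \<beta> x (k + i)) * \<beta> ^ (n - i))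
    = \<beta> ^ n * (beta_T \<beta> ^^ k) x - (beta_T \<beta> ^^ (k + n)) x"
proof (induction n)
  case (Suc n)
  have "(\<Sum>i=1..Suc n. of_int (beta_digit \<beta> x (k + i)) * \<beta> ^ (Suc n - i))
      = \<beta> * (\<Sum>i=1..n. of_int (beta_digit \<beta> x (k + i)) * \<beta> ^ (n - i))
        + of_int (beta_digit \<beta> x (Suc (k + n)))"
    by (simp add: sum_distrib_left Suc_diff_le algebra_simps)
  also have "\<dots> = \<beta> ^ Suc n * (beta_T \<beta> ^^ k) x - (beta_T \<beta> ^^ Suc (k + n)) x"
    unfolding Suc.IH funpow_beta_T_Suc by (simp add: algebra_simps)
  finally show ?case
    by simp
qed simp

lemma midy_property_iff:
  assumes "\<beta> > 1"
  shows "midy_property \<beta> q \<longleftrightarrow>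
    (\<exists>p>0. p < q \<and> coprime p q \<and>
      (\<exists>n\<ge>1. (beta_T \<beta> ^^ (2 * n)) (real p / real q) = real p / real q \<and>
        (\<forall>m\<ge>1. (beta_T \<beta> ^^ m) (real p / real q) = real p / real q \<longrightarrow> 2 * n \<le> m) \<and>
        (beta_T \<beta> ^^ n) (real p / real q) = 1 - real p / real q))"
proof -
  have "(\<exists>c. beta_expansion_repeats \<beta> x (2 * n) c \<and>
           (\<forall>m c'. beta_expansion_repeats \<beta> x m c' \<longrightarrow> 2 * n \<le> m) \<and>
           (\<Sum>i=1..n. of_int (c i) * \<beta> ^ (n - i)) +
           (\<Sum>i=1..n. of_int (c (n + i)) * \<beta> ^ (n - i)) = \<beta> ^ n - 1) \<longleftrightarrow>
      (beta_T \<beta> ^^ (2 * n)) x = x \<and> (\<forall>m\<ge>1. (beta_T \<beta> ^^ m) x = x \<longrightarrow> 2 * n \<le> m) \<and>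
        (beta_T \<beta> ^^ n) x = 1 - x"
    if n: "n \<ge> 1" and x: "0 \<le> x" "x < 1" for n :: nat and x
  proof -
    note rep = beta_expansion_repeats_iff[OF assms x]
    have least: "(\<forall>m c'. beta_expansion_repeats \<beta> x m c' \<longrightarrow> 2 * n \<le> m) \<longleftrightarrow>
        (\<forall>m\<ge>1. (beta_T \<beta> ^^ m) x = x \<longrightarrow> 2 * n \<le> m)"
      unfolding rep by blast
    have sums: "(\<Sum>i=1..n. of_int (c i) * \<beta> ^ (n - i)) +
        (\<Sum>i=1..n. of_int (c (n + i)) * \<beta> ^ (n - i)) = \<beta> ^ n - 1 \<longleftrightarrow>
        (beta_T \<beta> ^^ n) x = 1 - x"
      if c: "\<forall>i\<in>{1..2 * n}. c i = beta_digit \<beta> x i" and per: "(beta_T \<beta> ^^ (2 * n)) x = x" for c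
    proof -
      have "(\<Sum>i=1..n. of_int (c i) * \<beta> ^ (n - i)) = \<beta> ^ n * x - (beta_T \<beta> ^^ n) x"
        using c sum_beta_digits[of \<beta> x 0 n] by simp
      moreover have "(\<Sum>i=1..n. of_int (c (n + i)) * \<beta> ^ (n - i)) = \<beta> ^ n * (beta_T \<beta> ^^ n) x - x"
        using c sum_beta_digits[of \<beta> x n n] per by (simp add: mult_2)
      \<comment> \<open>The factor \<open>\<beta> ^ n - 1\<close> of the required sum splits off, so
        the condition becomes \<open>x + (beta_T \<beta> ^^ n) x = 1\<close>.\<close>
      ultimately have "(\<Sum>i=1..n. of_int (c i) * \<beta> ^ (n - i)) +
          (\<Sum>i=1..n. of_int (c (n + i)) * \<beta> ^ (n - i)) = (\<beta> ^ n - 1) * (x + (beta_T \<beta> ^^ n) x)"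
        by (simp add: algebra_simps)
      moreover have "\<beta> ^ n - 1 \<noteq> 0"
        using one_less_power[OF assms, of n] n by simp
      ultimately show ?thesis
        by auto
    qed
    have "1 \<le> 2 * n"
      using n by simp
    \<comment> \<open>The instance of \<open>sums\<close> at \<open>beta_digit \<beta> x\<close>
      provides the block \<open>c\<close> for the converse direction.\<close>
    then show ?thesis
      unfolding least rep using sums sums[of "beta_digit \<beta> x"] by blast
  qed
  then show ?thesis
    unfolding midy_property_def
    by (intro ex_cong1 conj_cong refl) (simp add: divide_less_eq)
qed

section \<open>The Fibonacci matrix modulo q\<close>

text \<open>The pair (a, b) stands for a + b\<tau>; the map is multiplication by \<tau>, because
  \<tau>^2 = \<tau> + 1.\<close>

definition fib_step :: "int \<times> int \<Rightarrow> int \<times> int" where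
  "fib_step v = (snd v, fst v + snd v)"

definition pair_cong :: "nat \<Rightarrow> int \<times> int \<Rightarrow> int \<times> int \<Rightarrow> bool" where
  "pair_cong q v w \<longleftrightarrow> [fst v = fst w] (mod int q) \<and> [snd v = snd w] (mod int q)"

text \<open>Expresses \<tau>^m = s in \<int>[\<tau>] modulo \<open>q\<close>, that is, C^m = sI
  modulo \<open>q\<close>. The image of 1 = (1, 0) decides this, since the action is multiplication
  by \<tau>^m.\<close>

definition fib_scalar :: "nat \<Rightarrow> int \<Rightarrow> nat \<Rightarrow> bool" where
  "fib_scalar q s m \<longleftrightarrow> pair_cong q ((fib_step ^^ m) (1, 0)) (s, 0)"

text \<open>The columns are the coordinates of \<tau>^m and \<tau>^(m+1).\<close>

lemma fib_mat_power:
  "fib_mat ^\<^sub>m m = mat 2 2 (\<lambda>(i, j). if i = 0 then (if j = 0 then fst else snd) ((fib_step ^^ m) (1, 0))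
     else (if j = 0 then snd ((fib_step ^^ m) (1, 0))
       else fst ((fib_step ^^ m) (1, 0)) + snd ((fib_step ^^ m) (1, 0))))"
proof (induction m)
  case 0
  show ?case
    by (rule eq_matI) (auto simp: fib_mat_def mat_of_rows_list_def less_2_cases_iff)
next
  case (Suc m)
  show ?case
    unfolding pow_mat.simps Suc
    by (rule eq_matI)
      (auto simp: fib_mat_def mat_of_rows_list_def less_2_cases_iff scalar_prod_def
        fib_step_def numeral_2_eq_2)
qed

lemma mat_cong_fib_mat_power_iff:
  "mat_cong (fib_mat ^\<^sub>m m) (- 1\<^sub>m 2) q \<longleftrightarrow> fib_scalar q (- 1) m"
proof -
  have all2: "(\<forall>i<2. P i) \<longleftrightarrow> P 0 \<and> P (1::nat)" for P
    by (auto simp: less_2_cases_iff)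
  show ?thesis
    unfolding mat_cong_def fib_mat_power fib_scalar_def pair_cong_def
    by (auto simp: all2 dest: cong_add)
qed

section \<open>Powers of \<tau> that are scalars modulo \<open>q\<close>\<close>

lemma fib_step_power_linear:
  "(fib_step ^^ m) (a, b) =
    (a * fst ((fib_step ^^ m) (1, 0)) + b * snd ((fib_step ^^ m) (1, 0)),
     a * snd ((fib_step ^^ m) (1, 0)) +
       b * (fst ((fib_step ^^ m) (1, 0)) + snd ((fib_step ^^ m) (1, 0))))"
  by (induction m) (simp_all add: fib_step_def algebra_simps)

lemma fib_scalar_funpow:
  assumes "fib_scalar q s m"
  shows "pair_cong q ((fib_step ^^ m) (a, b)) (s * a, s * b)"
proof -
  obtain u v where uv: "(fib_step ^^ m) (1, 0) = (u, v)"
    by force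
  then have u: "[u = s] (mod int q)" and v: "[v = 0] (mod int q)"
    using assms by (auto simp: fib_scalar_def pair_cong_def)
  have "[a * u + b * v = a * s + b * 0] (mod int q)"
    "[a * v + b * (u + v) = a * 0 + b * (s + 0)] (mod int q)"
    by (intro cong_add cong_mult cong_refl u v)+
  then show ?thesis
    unfolding fib_step_power_linear[of m a b] uv by (simp add: pair_cong_def mult.commute)
qed

lemma pair_cong_sym: "pair_cong q v w \<Longrightarrow> pair_cong q w v"
  by (auto simp: pair_cong_def cong_sym)

lemma pair_cong_trans: "pair_cong q u v \<Longrightarrow> pair_cong q v w \<Longrightarrow> pair_cong q u w"
  by (auto simp: pair_cong_def intro: cong_trans)

text \<open>\<open>p\<close> is a unit modulo \<open>q\<close> and cancels. This makes the orbit
  conditions independent of the numerator.\<close>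

lemma fib_scalar_iff:
  assumes "coprime p q"
  shows "fib_scalar q s m \<longleftrightarrow> pair_cong q ((fib_step ^^ m) (int p, 0)) (s * int p, 0)"
proof -
  have "coprime (int p) (int q)"
    using assms by simp
  then show ?thesis
    unfolding fib_step_power_linear[of m "int p" 0] fib_scalar_def pair_cong_def
    using cong_mult_lcancel[of "int p" "int q" "fst ((fib_step ^^ m) (1, 0))" s]
      cong_mult_lcancel[of "int p" "int q" "snd ((fib_step ^^ m) (1, 0))" 0]
    by (simp add: mult.commute)
qed

lemma fib_scalar_add_iff:
  assumes "fib_scalar q 1 m"
  shows "fib_scalar q s (m + n) \<longleftrightarrow> fib_scalar q s n"
proof -
  have "pair_cong q ((fib_step ^^ (m + n)) (1, 0)) ((fib_step ^^ n) (1, 0))"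
    using fib_scalar_funpow[OF assms, of "fst ((fib_step ^^ n) (1, 0))" "snd ((fib_step ^^ n) (1, 0))"]
    by (simp add: funpow_add)
  then show ?thesis
    unfolding fib_scalar_def using pair_cong_trans pair_cong_sym by blast
qed

lemma fib_scalar_mult_add_iff:
  assumes "fib_scalar q 1 m"
  shows "fib_scalar q s (m * t + n) \<longleftrightarrow> fib_scalar q s n"
  by (induction t) (simp_all add: fib_scalar_add_iff[OF assms] add.assoc)

lemma fib_scalar_double:
  assumes "fib_scalar q (- 1) n"
  shows "fib_scalar q 1 (2 * n)"
proof -
  obtain u v where uv: "(fib_step ^^ n) (1, 0) = (u, v)"
    by force
  have "[- u = - (- 1)] (mod int q)" "[- v = - 0] (mod int q)"
    using assms unfolding fib_scalar_def pair_cong_def uv by (simp_all only: cong_minus_minus_iff fst_conv snd_conv)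
  then have "pair_cong q (- 1 * u, - 1 * v) (1, 0)"
    by (simp add: pair_cong_def)
  moreover have "pair_cong q ((fib_step ^^ (n + n)) (1, 0)) (- 1 * u, - 1 * v)"
    using fib_scalar_funpow[OF assms, of u v] by (simp add: funpow_add uv)
  ultimately show ?thesis
    unfolding fib_scalar_def mult_2 using pair_cong_trans by blast
qed

text \<open>The quadratic form is the norm of u + v\<tau>, equivalently the determinant of C^m, and
  \<tau> has norm -1.\<close>

lemma fib_step_power_norm:
  "fst ((fib_step ^^ m) (1, 0)) ^ 2 + fst ((fib_step ^^ m) (1, 0)) * snd ((fib_step ^^ m) (1, 0))
    - snd ((fib_step ^^ m) (1, 0)) ^ 2 = (- 1) ^ m"
proof (induction m)
  case (Suc m)
  show ?case
    by (simp add: fib_step_def flip: Suc) (simp add: power2_eq_square algebra_simps)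
qed simp

lemma fib_scalar_unique:
  assumes "fib_scalar q s m" "fib_scalar q t m"
  shows "[s = t] (mod int q)"
  using assms unfolding fib_scalar_def pair_cong_def by (metis cong_sym cong_trans fst_conv)

lemma not_cong_minus_one:
  assumes "q > 2"
  shows "\<not> [- 1 = 1] (mod int q)"
proof
  assume "[- 1 = 1] (mod int q)"
  then have "int q dvd 2"
    by (metis cong_iff_dvd_diff diff_minus_eq_add dvd_minus_iff minus_diff_eq one_add_one)
  with assms show False
    by (auto dest: zdvd_imp_le)
qed

text \<open>The scalar -1 has norm 1, whereas \<tau>^n has norm (-1)^n.\<close>

lemma even_if_fib_scalar_minus_one:
  assumes "q > 2" "fib_scalar q (- 1) n"
  shows "even n"
proof (rule ccontr)
  assume "odd n"
  obtain u v where uv: "(fib_step ^^ n) (1, 0) = (u, v)"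
    by force
  then have "[u = - 1] (mod int q)" "[v = 0] (mod int q)"
    using assms by (auto simp: fib_scalar_def pair_cong_def)
  then have "[u ^ 2 + u * v - v ^ 2 = (- 1) ^ 2 + (- 1) * 0 - 0 ^ 2] (mod int q)"
    by (intro cong_add cong_diff cong_mult cong_pow)
  moreover have "u ^ 2 + u * v - v ^ 2 = - 1"
    using fib_step_power_norm[of n] \<open>odd n\<close> by (simp add: uv)
  ultimately show False
    using not_cong_minus_one[OF \<open>q > 2\<close>] by simp
qed

section \<open>Primes congruent to 1 or -1 modulo 5\<close>

text \<open>\<open>q\<close> is congruent to 1^2 or 2^2 modulo 5, and reciprocity carries no sign
  because 5 is 1 modulo 4.\<close>

lemma QuadRes_five:
  assumes "prime q" "[int q = 1] (mod 5) \<or> [int q = - 1] (mod 5)" "q > 5"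
  shows "QuadRes (int q) 5"
proof -
  have "\<not> [int q = 0] (mod 5)"
    using assms(2) by (auto simp: cong_def)
  moreover have "QuadRes 5 (int q)"
  proof (cases "[int q = 1] (mod 5)")
    case True
    then have "[1\<^sup>2 = int q] (mod 5)"
      by (simp add: cong_sym_eq)
    then show ?thesis
      unfolding QuadRes_def by blast
  next
    case False
    then have "[2\<^sup>2 = int q] (mod 5)"
      using assms(2) by (auto simp: cong_def)
    then show ?thesis
      unfolding QuadRes_def by blast
  qed
  ultimately have "Legendre (int q) 5 = 1"
    by (simp add: Legendre_def)
  moreover have "Legendre 5 (int q) * Legendre (int q) 5 = 1"
    using Quadratic_Reciprocity[of 5 q] assms by simp
  ultimately have "Legendre 5 (int q) = 1"
    by simp
  then show ?thesis
    by (auto simp: Legendre_def split: if_splits)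
qed

text \<open>Sending a + b\<tau> to a + b\<alpha> is a ring homomorphism into the integers modulo
  \<open>q\<close>.\<close>

lemma golden_root_power:
  assumes "[\<alpha> ^ 2 = \<alpha> + 1] (mod int q)"
  shows "[fst ((fib_step ^^ m) (1, 0)) + snd ((fib_step ^^ m) (1, 0)) * \<alpha> = \<alpha> ^ m] (mod int q)"
proof (induction m)
  case (Suc m)
  obtain u v where uv: "(fib_step ^^ m) (1, 0) = (u, v)"
    by force
  have "[(u + v * \<alpha>) * \<alpha> = \<alpha> ^ m * \<alpha>] (mod int q)"
    using Suc by (simp add: uv cong_mult)
  moreover have "(u + v * \<alpha>) * \<alpha> = u * \<alpha> + v * \<alpha> ^ 2"
    by (simp add: power2_eq_square algebra_simps)
  moreover have "[u * \<alpha> + v * \<alpha> ^ 2 = u * \<alpha> + v * (\<alpha> + 1)] (mod int q)"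
    by (intro cong_add cong_mult cong_refl assms)
  moreover have "u * \<alpha> + v * (\<alpha> + 1) = v + (u + v) * \<alpha>"
    by (simp add: algebra_simps)
  ultimately have "[v + (u + v) * \<alpha> = \<alpha> ^ m * \<alpha>] (mod int q)"
    by (metis cong_sym cong_trans)
  moreover have "(fib_step ^^ Suc m) (1, 0) = (v, u + v)"
    by (simp add: uv) (simp add: fib_step_def)
  ultimately show ?case
    by (simp add: mult.commute del: funpow.simps)
qed simp

lemma int_fermat:
  assumes "prime q" "\<not> int q dvd a"
  shows "[a ^ (q - 1) = 1] (mod int q)"
proof -
  define b where "b = nat (a mod int q)"
  have q: "int q > 0"
    using assms(1) prime_gt_0_nat by simp
  have b: "int b = a mod int q"
    using q by (simp add: b_def)
  have "\<not> q dvd b"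
  proof
    assume "q dvd b"
    then have "int q dvd int b" by simp
    with b assms(2) show False
      by (simp add: dvd_mod_iff)
  qed
  then have "[b ^ (q - 1) = 1] (mod q)"
    by (rule fermat_theorem[OF assms(1)])
  then have "[int b ^ (q - 1) = 1] (mod int q)"
    by (metis cong_int_iff of_nat_1 of_nat_power)
  moreover have "[int b = a] (mod int q)"
    by (simp add: b cong_def)
  ultimately show ?thesis
    by (meson cong_pow cong_sym cong_trans)
qed

text \<open>Modulo \<open>q\<close> the polynomial x^2 - x - 1 has two roots (1 + r)/2 and (1 -
  r)/2, where r^2 = 5. By Fermat, u + v\<gamma> = 1 holds at both roots, where (u, v) are the
  coordinates of \<tau>^(q-1). The roots differ by the unit r, which forces v = 0 and u = 1.\<close>

lemma fib_scalar_prime_minus_one: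
  assumes "prime q" "[int q = 1] (mod 5) \<or> [int q = - 1] (mod 5)" "q > 5"
  shows "fib_scalar q 1 (q - 1)"
proof -
  have pq: "prime (int q)"
    using assms(1) by simp
  obtain r where r: "[r ^ 2 = 5] (mod int q)"
    using QuadRes_five[OF assms] by (auto simp: QuadRes_def)
  obtain h where h: "[2 * h = 1] (mod int q)"
  proof -
    have "coprime 2 (int q)"
      using primes_coprime[of 2 "int q"] pq \<open>q > 5\<close> by auto
    then show ?thesis
      using cong_solve_coprime_int[of 2 "int q"] that by auto
  qed
  have root: "[(h * (1 + s)) ^ 2 = h * (1 + s) + 1] (mod int q)"
    if s: "[s ^ 2 = 5] (mod int q)" for s
  proof -
    have "int q dvd 2 * h - 1" "int q dvd s ^ 2 - 5"
      using h s by (simp_all add: cong_iff_dvd_diff)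
    \<comment> \<open>The cofactors are chosen so that this combination is exactly x^2 - x - 1 at x
      = h(1 + s), with \<open>h\<close> in the role of 1/2.\<close>
    then have "int q dvd (2 * h - 1) * (h * (s + 3) + 1) + h ^ 2 * (s ^ 2 - 5)"
      by simp
    also have "(2 * h - 1) * (h * (s + 3) + 1) + h ^ 2 * (s ^ 2 - 5)
        = (h * (1 + s)) ^ 2 - (h * (1 + s) + 1)"
      by (simp add: power2_eq_square algebra_simps)
    finally show ?thesis
      by (simp add: cong_iff_dvd_diff)
  qed
  define \<alpha> where "\<alpha> = h * (1 + r)"
  define \<beta> where "\<beta> = h * (1 + (- r))"
  have \<alpha>: "[\<alpha> ^ 2 = \<alpha> + 1] (mod int q)"
    unfolding \<alpha>_def by (rule root[OF r])
  have \<beta>: "[\<beta> ^ 2 = \<beta> + 1] (mod int q)"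
    unfolding \<beta>_def by (rule root) (use r in simp)
  obtain u v where uv: "(fib_step ^^ (q - 1)) (1, 0) = (u, v)"
    by force
  have one: "[u + v * \<gamma> = 1] (mod int q)" if \<gamma>: "[\<gamma> ^ 2 = \<gamma> + 1] (mod int q)" for \<gamma>
  proof -
    have "\<not> int q dvd \<gamma>"
    proof
      assume "int q dvd \<gamma>"
      moreover have "int q dvd \<gamma> ^ 2 - (\<gamma> + 1)"
        using \<gamma> by (simp add: cong_iff_dvd_diff)
      \<comment> \<open>A root \<gamma> is a unit modulo \<open>q\<close> with inverse \<gamma> -
        1.\<close>
      ultimately have "int q dvd \<gamma> * (\<gamma> - 1) - (\<gamma> ^ 2 - (\<gamma> + 1))"
        by (metis dvd_diff dvd_mult2)
      also have "\<gamma> * (\<gamma> - 1) - (\<gamma> ^ 2 - (\<gamma> + 1)) = 1"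
        by (simp add: power2_eq_square algebra_simps)
      finally show False
        using pq by (simp add: prime_int_iff)
    qed
    then show ?thesis
      using int_fermat[OF assms(1)] golden_root_power[OF \<gamma>, of "q - 1"] uv
      by (metis cong_trans fst_conv snd_conv)
  qed
  have "int q dvd (u + v * \<alpha> - 1) - (u + v * \<beta> - 1)"
    using dvd_diff[OF one[OF \<alpha>, unfolded cong_iff_dvd_diff] one[OF \<beta>, unfolded cong_iff_dvd_diff]] .
  moreover have "(u + v * \<alpha> - 1) - (u + v * \<beta> - 1) = (2 * h - 1) * (v * r) + v * r"
    by (simp add: \<alpha>_def \<beta>_def algebra_simps)
  moreover have "int q dvd (2 * h - 1) * (v * r)"
    using h by (simp add: cong_iff_dvd_diff)
  ultimately have "int q dvd v * r"
    by (metis dvd_add_right_iff)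
  moreover have "\<not> int q dvd r"
  proof
    assume "int q dvd r"
    then have "[r ^ 2 = 0] (mod int q)"
      by (simp add: cong_0_iff power2_eq_square)
    then have "[5 = 0] (mod int q)"
      using r by (meson cong_sym cong_trans)
    then have "int q dvd 5"
      by (simp add: cong_0_iff)
    with \<open>q > 5\<close> show False
      by (auto dest: zdvd_imp_le)
  qed
  ultimately have v: "int q dvd v"
    using pq by (simp add: prime_dvd_mult_iff)
  have "int q dvd (u + v * \<alpha> - 1) - v * \<alpha>"
    using dvd_diff[OF one[OF \<alpha>, unfolded cong_iff_dvd_diff] dvd_mult2[OF v]] .
  then show ?thesis
    unfolding fib_scalar_def pair_cong_def uv
    using v by (simp add: cong_iff_dvd_diff)
qed

section \<open>The natural extension of the golden ratio transformation\<close>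

abbreviation "\<tau> \<equiv> golden_ratio"

lemma golden_ratio_square: "\<tau> * \<tau> = \<tau> + 1"
  by (simp add: golden_ratio_def field_simps)

lemma golden_ratio_mult_mult: "\<tau> * (\<tau> * x) = \<tau> * x + x"
  by (simp add: golden_ratio_square distrib_right flip: mult.assoc)

lemma golden_ratio_bounds: "8 / 5 < \<tau>" "\<tau> < 5 / 3"
proof -
  have "11 / 5 < sqrt 5" "sqrt 5 < 7 / 3"
    by (rule real_less_rsqrt, simp add: power2_eq_square)
      (rule real_less_lsqrt, simp_all add: power2_eq_square)
  then show "8 / 5 < \<tau>" "\<tau> < 5 / 3"
    by (simp_all add: golden_ratio_def)
qed

text \<open>The relation yields (2a + b)^2 = 5b^2. For nonzero b the exponent of 5 is even on the
  left and odd on the right.\<close>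

lemma golden_ratio_irrational:
  fixes a b :: int
  assumes "of_int a + of_int b * \<tau> = 0"
  shows "a = 0 \<and> b = 0"
proof -
  have "real_of_int (2 * a + b) = - of_int b * sqrt 5"
    using assms by (simp add: golden_ratio_def field_simps)
  then have "real_of_int (2 * a + b) ^ 2 = of_int b ^ 2 * 5"
    by (simp add: power_mult_distrib)
  then have "real_of_int ((2 * a + b) ^ 2) = real_of_int (5 * b ^ 2)"
    by simp
  then have eq: "(2 * a + b) ^ 2 = 5 * b ^ 2"
    by (simp only: of_int_eq_iff)
  have "b = 0"
  proof (rule ccontr)
    assume "b \<noteq> 0"
    then have "2 * a + b \<noteq> 0"
      using eq by auto
    have p5: "prime_elem (5 :: int)"
      by simp
    have "2 * multiplicity 5 (2 * a + b) = multiplicity 5 ((2 * a + b) ^ 2)"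
      using \<open>2 * a + b \<noteq> 0\<close> by (simp add: prime_elem_multiplicity_power_distrib[OF p5])
    also have "\<dots> = Suc (2 * multiplicity 5 b)"
      unfolding eq using \<open>b \<noteq> 0\<close>
      by (simp add: prime_elem_multiplicity_mult_distrib[OF p5]
          prime_elem_multiplicity_power_distrib[OF p5])
    finally show False
      by presburger
  qed
  with eq show ?thesis
    by simp
qed

text \<open>
  \<open>x\<close> is a point of the unit interval and \<open>y\<close> its Galois conjugate. The area of this region is
  \<open>sqrt 5\<close>, the covolume of \<open>\<int>[\<tau>]\<close>.
\<close>

definition natural_ext :: "real \<Rightarrow> real \<Rightarrow> bool" where
  "natural_ext x y \<longleftrightarrow> 0 \<le> x \<and> x < 1 \<and> - \<tau> < y \<and> y < 1 \<and> (\<tau> - 1 \<le> x \<longrightarrow> 1 - \<tau> \<le> y)"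

lemma natural_ext_step:
  assumes "natural_ext x y"
  shows "natural_ext (beta_T \<tau> x) ((1 - \<tau>) * y - of_int \<lfloor>\<tau> * x\<rfloor>)"
proof -
  note b = golden_ratio_bounds
  have xy: "0 \<le> x" "x < 1" "- \<tau> < y" "y < 1"
    using assms by (auto simp: natural_ext_def)
  have "(1 - \<tau>) * 1 < (1 - \<tau>) * y"
    using xy b by (intro mult_strict_left_mono_neg) auto
  moreover have "(1 - \<tau>) * y < (1 - \<tau>) * (- \<tau>)"
    using xy b by (intro mult_strict_left_mono_neg) auto
  moreover define z where "z = (1 - \<tau>) * y"
  ultimately have z: "1 - \<tau> < z" "z < 1"
    using golden_ratio_square by (simp_all add: algebra_simps)
  show ?thesis
  proof (cases "\<tau> * x < 1")
    case True
    then have "\<lfloor>\<tau> * x\<rfloor> = 0"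
      using xy b by (simp add: floor_eq_iff)
    then show ?thesis
      unfolding z_def[symmetric] using z b True xy by (simp add: natural_ext_def beta_T_def)
  next
    case False
    have "\<tau> * x < \<tau> * 1"
      using xy b by (intro mult_strict_left_mono) auto
    moreover define t where "t = \<tau> * x"
    ultimately have t: "1 \<le> t" "t < \<tau>"
      using False by simp_all
    then have fl: "\<lfloor>t\<rfloor> = 1"
      using b by (simp add: floor_eq_iff)
    \<comment> \<open>As \<tau>(\<tau> - 1) = 1, digit 1 begins exactly at the corner x = \<tau> - 1
      of the region.\<close>
    have "\<tau> * (\<tau> - 1) \<le> \<tau> * x"
      using False golden_ratio_square by (simp add: algebra_simps)
    then have "1 - \<tau> \<le> y"
      using assms b by (simp add: natural_ext_def)
    then have "(1 - \<tau>) * y \<le> (1 - \<tau>) * (1 - \<tau>)"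
      using b by (intro mult_left_mono_neg) auto
    then have "z \<le> 2 - \<tau>"
      unfolding z_def using golden_ratio_square by (simp add: algebra_simps)
    then show ?thesis
      unfolding beta_T_def t_def[symmetric] z_def[symmetric] fl
      using z b t by (simp add: natural_ext_def)
  qed
qed

text \<open>Distinct lattice translates of the region are disjoint. Its size leaves only v = -1, 0,
  1, and the notch of the L-shape excludes v = 1 and v = -1.\<close>

lemma natural_ext_unique:
  fixes u v :: int
  assumes "natural_ext x y"
    and "natural_ext (x + (of_int u + of_int v * \<tau>)) (y + (of_int u + of_int v * (1 - \<tau>)))"
  shows "u = 0 \<and> v = 0"
proof -
  note b = golden_ratio_bounds
  note A = assms(1)[unfolded natural_ext_def] and B = assms(2)[unfolded natural_ext_def]
  \<comment> \<open>Subtracting the conjugate shift from the shift eliminates \<open>u\<close>; the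
    factor 2\<tau> - 1 is the square root of 5.\<close>
  define w where "w = of_int v * (2 * \<tau> - 1)"
  have w: "w = (of_int u + of_int v * \<tau>) - (of_int u + of_int v * (1 - \<tau>))"
    by (simp add: w_def algebra_simps)
  have "- 4 < w"
    unfolding w using A B b by linarith
  have "w < 4"
    unfolding w using A B b by linarith
  have "v < 2"
  proof (rule ccontr)
    assume "\<not> v < 2"
    then have "2 * (2 * \<tau> - 1) \<le> w"
      unfolding w_def using b by (intro mult_right_mono) auto
    with \<open>w < 4\<close> b show False by simp
  qed
  moreover have "- 2 < v"
  proof (rule ccontr)
    assume "\<not> - 2 < v"
    then have "w \<le> (- 2) * (2 * \<tau> - 1)"
      unfolding w_def using b by (intro mult_right_mono) auto
    with \<open>- 4 < w\<close> b show False by simp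
  qed
  ultimately consider "v = 0" | "v = 1" | "v = - 1"
    by linarith
  then show ?thesis
  proof cases
    case 1
    with A B show ?thesis by simp
  next
    case 2
    have "of_int u < (0 :: real)"
      using A B[unfolded 2 of_int_1 mult_1] b by linarith
    moreover have "- 2 < (of_int u :: real)"
      using A B[unfolded 2 of_int_1 mult_1] b by linarith
    ultimately have "u = - 1" by linarith
    \<comment> \<open>The shift moves x to x + \<tau> - 1 and y to y - \<tau>. The new first
      coordinate is at least \<tau> - 1, so y - \<tau> would be at least 1 - \<tau>, against y <
      1.\<close>
    with 2 A B b show ?thesis by simp
  next
    case 3
    have "0 < (of_int u :: real)"
      using A B[unfolded 3 of_int_minus of_int_1 mult_minus_left mult_1] b by linarith
    moreover have "of_int u < (2 :: real)"
      using A B[unfolded 3 of_int_minus of_int_1 mult_minus_left mult_1] b by linarith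
    ultimately have "u = 1" by linarith
    \<comment> \<open>The same contradiction with the two points exchanged.\<close>
    with 3 A B b show ?thesis by simp
  qed
qed

section \<open>Orbits of points of \<int>[\<tau>] divided by \<open>q\<close>\<close>

definition golden_point :: "nat \<Rightarrow> int \<times> int \<Rightarrow> real" where
  "golden_point q v = (of_int (fst v) + of_int (snd v) * \<tau>) / real q"

definition golden_conj :: "nat \<Rightarrow> int \<times> int \<Rightarrow> real" where
  "golden_conj q v = (of_int (fst v) + of_int (snd v) * (1 - \<tau>)) / real q"

lemma golden_point_orbit:
  assumes "q > 0" "natural_ext (golden_point q v) (golden_conj q v)"
  shows "\<exists>w. pair_cong q w ((fib_step ^^ m) v) \<and>
    natural_ext (golden_point q w) (golden_conj q w) \<and>
    golden_point q w = (beta_T \<tau> ^^ m) (golden_point q v)"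
proof (induction m)
  case 0
  show ?case
    using assms by (intro exI[of _ v]) (simp add: pair_cong_def)
next
  case (Suc m)
  then obtain w where w: "pair_cong q w ((fib_step ^^ m) v)"
    "natural_ext (golden_point q w) (golden_conj q w)"
    "golden_point q w = (beta_T \<tau> ^^ m) (golden_point q v)"
    by blast
  define d where "d = \<lfloor>\<tau> * golden_point q w\<rfloor>"
  \<comment> \<open>Subtracting the digit \<open>d\<close> from the point removes
    \<open>d * int q\<close> from the first coordinate, which is invisible modulo
    \<open>q\<close>.\<close>
  define w' where "w' = (snd w - d * int q, fst w + snd w)"
  have "golden_point q w' = \<tau> * golden_point q w - of_int d"
    using \<open>q > 0\<close>
    by (simp add: golden_point_def w'_def field_simps golden_ratio_mult_mult)
  then have T: "golden_point q w' = beta_T \<tau> (golden_point q w)"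
    by (simp add: beta_T_def d_def)
  have "golden_conj q w' = (1 - \<tau>) * golden_conj q w - of_int d"
    using \<open>q > 0\<close>
    by (simp add: golden_conj_def w'_def field_simps golden_ratio_mult_mult)
  then have "natural_ext (golden_point q w') (golden_conj q w')"
    using natural_ext_step[OF w(2)] by (simp add: T d_def)
  moreover have "pair_cong q w' ((fib_step ^^ Suc m) v)"
  proof -
    have "[snd w - d * int q = snd ((fib_step ^^ m) v) - 0] (mod int q)"
      using w(1) by (intro cong_diff) (simp_all add: pair_cong_def cong_0_iff)
    then show ?thesis
      using w(1) by (simp add: pair_cong_def w'_def fib_step_def cong_add)
  qed
  ultimately show ?case
    using T w(3) by (intro exI[of _ w']) simp
qed

text \<open>Equal points have equal coordinates by irrationality. Congruent pairs give points that
  differ by an element of \<int>[\<tau>], and the region contains at most one point of each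
  coset.\<close>

lemma golden_point_eq_iff:
  assumes "q > 0" "natural_ext (golden_point q v) (golden_conj q v)"
    "natural_ext (golden_point q w) (golden_conj q w)"
  shows "golden_point q v = golden_point q w \<longleftrightarrow> pair_cong q v w"
proof
  assume "golden_point q v = golden_point q w"
  then have "of_int (fst v - fst w) + of_int (snd v - snd w) * \<tau> = 0"
    using \<open>q > 0\<close> by (simp add: golden_point_def algebra_simps)
  then have "fst v - fst w = 0 \<and> snd v - snd w = 0"
    by (rule golden_ratio_irrational)
  then show "pair_cong q v w"
    by (simp add: pair_cong_def)
next
  assume "pair_cong q v w"
  then obtain a b where "fst w - fst v = int q * a" "snd w - snd v = int q * b"
    by (metis pair_cong_def cong_iff_dvd_diff cong_sym dvdE)
  then have ab: "fst w = fst v + int q * a" "snd w = snd v + int q * b"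
    by simp_all
  have "golden_point q w = golden_point q v + (of_int a + of_int b * \<tau>)"
    "golden_conj q w = golden_conj q v + (of_int a + of_int b * (1 - \<tau>))"
    using \<open>q > 0\<close> by (simp_all add: golden_point_def golden_conj_def ab field_simps)
  then have "a = 0 \<and> b = 0"
    using natural_ext_unique[OF assms(2), of a b] assms(3) by simp
  then show "golden_point q v = golden_point q w"
    by (simp add: golden_point_def ab)
qed

text \<open>A rational number is its own conjugate, so both fractions lie on the diagonal of the
  region.\<close>

lemma golden_orbit_eq_iff:
  assumes "0 < p" "p < q" "0 < r" "r < q"
  shows "(beta_T \<tau> ^^ m) (real p / real q) = real r / real q \<longleftrightarrow>
    pair_cong q ((fib_step ^^ m) (int p, 0)) (int r, 0)"
proof -
  have ext: "natural_ext (golden_point q (int i, 0)) (golden_conj q (int i, 0))"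
    if "0 < i" "i < q" for i
  proof -
    have "0 < real i / real q" "real i / real q < 1"
      using that by simp_all
    then show ?thesis
      using golden_ratio_bounds
      by (simp add: natural_ext_def golden_point_def golden_conj_def del: divide_less_eq_1 zero_less_divide_iff)
  qed
  have point: "golden_point q (int i, 0) = real i / real q" for i
    by (simp add: golden_point_def)
  have "q > 0"
    using assms by simp
  from golden_point_orbit[OF this ext[OF assms(1,2)], of m] obtain w where
    w: "pair_cong q w ((fib_step ^^ m) (int p, 0))"
    "natural_ext (golden_point q w) (golden_conj q w)"
    "golden_point q w = (beta_T \<tau> ^^ m) (golden_point q (int p, 0))"
    by blast
  have "(beta_T \<tau> ^^ m) (real p / real q) = real r / real q \<longleftrightarrow> pair_cong q w (int r, 0)"
    using golden_point_eq_iff[OF \<open>q > 0\<close> w(2) ext[OF assms(3,4)]] w(3) by (simp add: point)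
  then show ?thesis
    using w(1) pair_cong_trans pair_cong_sym by blast
qed

text \<open>With target q - p, which is -p modulo \<open>q\<close>, the orbit condition for 1 - p/q
  says \<tau>^n = -1. No condition on n depends on p any more, and p = 1 is an admissible
  numerator.\<close>

lemma midy_property_golden_ratio_iff:
  assumes "q > 1"
  shows "midy_property \<tau> q \<longleftrightarrow>
    (\<exists>n\<ge>1. fib_scalar q 1 (2 * n) \<and> (\<forall>m\<ge>1. fib_scalar q 1 m \<longrightarrow> 2 * n \<le> m) \<and>
      fib_scalar q (- 1) n)"
proof -
  have per: "(beta_T \<tau> ^^ m) (real p / real q) = real p / real q \<longleftrightarrow> fib_scalar q 1 m"
    and anti: "(beta_T \<tau> ^^ m) (real p / real q) = 1 - real p / real q \<longleftrightarrow> fib_scalar q (- 1) m"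
    if p: "0 < p" "p < q" "coprime p q" for p m
  proof -
    show "(beta_T \<tau> ^^ m) (real p / real q) = real p / real q \<longleftrightarrow> fib_scalar q 1 m"
      using p by (simp add: golden_orbit_eq_iff fib_scalar_iff[OF p(3)])
    have "1 - real p / real q = real (q - p) / real q"
      using p by (simp add: of_nat_diff field_simps)
    moreover have "(beta_T \<tau> ^^ m) (real p / real q) = real (q - p) / real q \<longleftrightarrow>
        pair_cong q ((fib_step ^^ m) (int p, 0)) (int (q - p), 0)"
      using p by (intro golden_orbit_eq_iff) auto
    moreover have "pair_cong q v (int (q - p), 0) \<longleftrightarrow> pair_cong q v (- 1 * int p, 0)" for v
      using p by (simp add: pair_cong_def of_nat_diff cong_def)
    ultimately show "(beta_T \<tau> ^^ m) (real p / real q) = 1 - real p / real q \<longleftrightarrow> fib_scalar q (- 1) m"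
      unfolding fib_scalar_iff[OF p(3)] by (simp only:)
  qed
  have "\<tau> > 1"
    using golden_ratio_bounds by simp
  have "midy_property \<tau> q \<longleftrightarrow>
    (\<exists>p>0. p < q \<and> coprime p q \<and>
      (\<exists>n\<ge>1. fib_scalar q 1 (2 * n) \<and> (\<forall>m\<ge>1. fib_scalar q 1 m \<longrightarrow> 2 * n \<le> m) \<and>
        fib_scalar q (- 1) n))"
    unfolding midy_property_iff[OF \<open>\<tau> > 1\<close>]
    by (intro ex_cong1 conj_cong refl) (simp_all add: per anti)
  moreover have "\<exists>p>0. p < q \<and> coprime p q"
    using assms by (intro exI[of _ 1]) simp
  ultimately show ?thesis
    by blast
qed

section \<open>Divisibility of the order\<close>

lemma fib_period_dvd:
  assumes "fib_scalar q 1 d" "d \<ge> 1" "\<And>m. m \<ge> 1 \<Longrightarrow> fib_scalar q 1 m \<Longrightarrow> d \<le> m"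
    and "fib_scalar q 1 m"
  shows "d dvd m"
proof (rule ccontr)
  assume "\<not> d dvd m"
  then have "m mod d \<ge> 1"
    by (simp add: Suc_leI mod_greater_zero_iff_not_dvd)
  moreover have "fib_scalar q 1 (m mod d)"
    using fib_scalar_mult_add_iff[OF assms(1), of 1 "m div d" "m mod d"] assms(4) by simp
  ultimately have "d \<le> m mod d"
    by (rule assms(3))
  moreover have "m mod d < d"
    using assms(2) by (intro mod_less_divisor) simp
  ultimately show False
    by simp
qed

lemma fib_scalar_odd_mult_iff:
  assumes "fib_scalar q 1 (2 * n)" "odd t"
  shows "fib_scalar q s (n * t) \<longleftrightarrow> fib_scalar q s n"
proof -
  obtain f where "t = 2 * f + 1"
    using assms(2) by (rule oddE)
  then have "n * t = 2 * n * f + n"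
    by (simp add: algebra_simps)
  then show ?thesis
    using fib_scalar_mult_add_iff[OF assms(1)] by simp
qed

section \<open>From the order of C modulo \<open>q\<close> to the list of matrices\<close>

theorem theorem5p4:
  fixes q k l :: nat
  assumes "prime q"
    and "[int q = 1] (mod 5) \<or> [int q = - 1] (mod 5)"
    and "q - 1 = 2 ^ k * l"
    and "odd l"
  shows "midy_property golden_ratio q \<longleftrightarrow>
    (\<exists>j\<in>{1..k - 1}. mat_cong (fib_mat ^\<^sub>m (2 ^ j * l)) (- 1\<^sub>m 2) q)"
proof -
  \<comment> \<open>The congruence excludes 2, 3 and 5; primality excludes 4.\<close>
  have "q \<noteq> 2" "q \<noteq> 3" "q \<noteq> 4" "q \<noteq> 5" "q \<ge> 2"
    using assms(1,2) prime_ge_2_nat[of q] by (auto simp: cong_def)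
  then have q: "q > 5" by simp
  show ?thesis
    unfolding mat_cong_fib_mat_power_iff
  proof
    assume "midy_property \<tau> q"
    then obtain n where n: "n \<ge> 1" "fib_scalar q 1 (2 * n)" "fib_scalar q (- 1) n"
      and least: "\<And>m. m \<ge> 1 \<Longrightarrow> fib_scalar q 1 m \<Longrightarrow> 2 * n \<le> m"
      using q by (auto simp: midy_property_golden_ratio_iff)
    have "2 * n dvd 2 ^ k * l"
      unfolding assms(3)[symmetric]
      by (rule fib_period_dvd[OF n(2) _ least fib_scalar_prime_minus_one[OF assms(1,2) q]])
        (use n(1) in simp)
    have "even n"
      using even_if_fib_scalar_minus_one[OF _ n(3)] q by simp
    \<comment> \<open>The power of 2 in \<open>n\<close> gives the index: j is at least 1 since
      \<open>n\<close> is even, and at most k - 1 since 2n divides q - 1.\<close>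
    define j where "j = multiplicity 2 n"
    obtain m where jm: "n = 2 ^ j * m" "odd m"
      unfolding j_def by (rule multiplicity_decompose'[of n 2]) (use n(1) in auto)
    have "j \<ge> 1"
      using jm \<open>even n\<close> by (cases j) auto
    have "2 ^ Suc j dvd 2 ^ k * l" "m dvd 2 ^ k * l"
      using \<open>2 * n dvd 2 ^ k * l\<close> jm(1) by (auto intro: dvd_trans[rotated])
    then have "2 ^ Suc j dvd (2 ^ k :: nat)" "m dvd l"
      using \<open>odd l\<close> \<open>odd m\<close>
      by (simp_all only: coprime_dvd_mult_left_iff coprime_dvd_mult_right_iff
          coprime_power_left_iff coprime_power_right_iff coprime_left_2_iff_odd
          coprime_right_2_iff_odd simp_thms)
    then have "Suc j \<le> k"
      using power_dvd_imp_le[of 2 "Suc j" k] by simp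
    obtain t where t: "l = m * t"
      using \<open>m dvd l\<close> by (rule dvdE)
    then have "odd t"
      using \<open>odd l\<close> by simp
    \<comment> \<open>The exponent is the odd multiple n * t of n, so the scalar remains -1.\<close>
    then have "fib_scalar q (- 1) (2 ^ j * l)"
      using n(3) fib_scalar_odd_mult_iff[OF n(2)] t jm(1) by (simp add: mult.assoc)
    with \<open>j \<ge> 1\<close> \<open>Suc j \<le> k\<close> show "\<exists>j\<in>{1..k - 1}. fib_scalar q (- 1) (2 ^ j * l)"
      by (intro bexI[of _ j]) auto
  next
    assume "\<exists>j\<in>{1..k - 1}. fib_scalar q (- 1) (2 ^ j * l)"
    then obtain N where N: "N \<ge> 1" "fib_scalar q (- 1) N"
      using \<open>odd l\<close> by (metis One_nat_def Suc_leI nat_0_less_mult_iff odd_pos zero_less_numeral zero_less_power)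
    have N2: "fib_scalar q 1 (2 * N)"
      by (rule fib_scalar_double[OF N(2)])
    \<comment> \<open>The order of \<tau> modulo \<open>q\<close>; \<open>2 * N\<close> shows that
      it exists.\<close>
    define d where "d = (LEAST m. m \<ge> 1 \<and> fib_scalar q 1 m)"
    have d: "d \<ge> 1 \<and> fib_scalar q 1 d"
      unfolding d_def by (rule LeastI[of _ "2 * N"]) (use N(1) N2 in simp)
    have least: "d \<le> m" if "m \<ge> 1" "fib_scalar q 1 m" for m
      unfolding d_def by (rule Least_le) (use that in simp)
    have "d dvd 2 * N"
      using fib_period_dvd[OF _ _ least N2] d by blast
    then obtain e where e: "2 * N = d * e"
      by (rule dvdE)
    \<comment> \<open>Otherwise d would divide N and \<tau>^N would be 1 instead of -1. Hence d is
      even, and its half n has N as an odd multiple, which carries -1 from N to n.\<close>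
    have "odd e"
    proof
      assume "even e"
      then obtain f where "e = 2 * f"
        by (rule evenE)
      then have "N = d * f + 0"
        using e by simp
      moreover have "fib_scalar q 1 0"
        by (simp add: fib_scalar_def pair_cong_def)
      ultimately have "fib_scalar q 1 N"
        using fib_scalar_mult_add_iff d by blast
      then have "[- 1 = 1] (mod int q)"
        using fib_scalar_unique[OF N(2)] by blast
      with q not_cong_minus_one show False by simp
    qed
    moreover have "even (d * e)"
      by (simp flip: e)
    ultimately obtain n where n: "d = 2 * n"
      by auto
    then have "N = n * e"
      using e by simp
    then have "fib_scalar q (- 1) n"
      using fib_scalar_odd_mult_iff[of q n e] d n \<open>odd e\<close> N(2) by simp
    moreover have "n \<ge> 1"
      using d n by simp
    ultimately show "midy_property \<tau> q"
      using q d n least by (auto simp: midy_property_golden_ratio_iff intro!: exI[of _ n])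
  qed
qed

end
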